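(* Let $V$ be a finite set and let $L,L'\in P_{\ge 2}(V)\setminus\{V\}$. Then the following conditions are equivalent: (i) $\mathcal{B}_2(V,L)+\mathcal{B}_2(V,L')$ is a BRSC; (ii) $\mathcal{B}_2(V,L)+\mathcal{B}_2(V,L')$ is a TBRSC; (iii) $|L\setminus L'|\le 3$ or $|L'\setminus L|\le 3$.
   Context: $P_k(V)$, $P_{\le k}(V)$, $P_{\ge k}(V)$ denote the sets of subsets of $V$ with exactly, at most, at least $k$ elements. For $L\in P_{\ge2}(V)\setminus\{V\}$, $\mathcal{B}_2(V,L)=(V,B_2(V,L))$ with $B_2(V,L)=P_{\le 2}(V)\cup\{X\in P_3(V): |X\cap L|=2\}$. For simplicial complexes $(V,H)$, $(V,H')$ on the same vertex set, their sum is $(V,H+H')$ with $H+H'=\{I\cup I' : I\in H,\ I'\in H'\}$. A simplicial complex $(V,H)$ ($H$ containing all singletons, closed under subsets) is boolean representable (BRSC) if it admits a boolean matrix representation; equivalently every face $\{x_1,\dots,x_k\}$ admits (for a suitable enumeration) a chain of flats $F_0\subset\cdots\subset F_k$ with $x_i\in F_i\setminus F_{i-1}$, where a flat is $F\subseteq V$ with $X\cup\{p\}\in H$ for all $X\in H$, $X\subseteq F$, $p\in V\setminus F$. A TBRSC is a complex of the form $(V,J\cap P_{\le k}(V))$ for some BRSC $(V,J)$ and some $k\ge1$. *)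

theory Defs
  imports Main
begin

definition subsets_le :: "nat \<Rightarrow> 'a set \<Rightarrow> 'a set set"  (\<open>P\<^sub>\<le>\<close>) where
  "P\<^sub>\<le> k V = {X. X \<subseteq> V \<and> card X \<le> k}"

definition subsets_eq :: "nat \<Rightarrow> 'a set \<Rightarrow> 'a set set"  (\<open>P\<^sub>=\<close>) where
  "P\<^sub>= k V = {X. X \<subseteq> V \<and> card X = k}"

definition subsets_ge :: "nat \<Rightarrow> 'a set \<Rightarrow> 'a set set"  (\<open>P\<^sub>\<ge>\<close>) where
  "P\<^sub>\<ge> k V = {X. X \<subseteq> V \<and> card X \<ge> k}"

definition simplicial_complex :: "'a set \<Rightarrow> 'a set set \<Rightarrow> bool" where
  "simplicial_complex V H \<longleftrightarrow>
     finite V \<and> H \<subseteq> Pow V \<and> H \<noteq> {} \<and> P\<^sub>= 1 V \<subseteq> H \<and>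
     (\<forall>X\<in>H. \<forall>Y. Y \<subseteq> X \<longrightarrow> Y \<in> H)"

text \<open>
  A square boolean matrix is nonsingular (its permanent over the superboolean semiring is 1) iff
  independent permutations of its rows and columns turn it into a lower unitriangular matrix.
  The lists \<^term>\<open>ys\<close> and \<^term>\<open>xs\<close> are the permuted row and column indices of the submatrix
  with row set \<^term>\<open>Y\<close> and column set \<^term>\<open>X\<close>.
\<close>

definition nonsingular :: "('r \<Rightarrow> 'a \<Rightarrow> bool) \<Rightarrow> 'r set \<Rightarrow> 'a set \<Rightarrow> bool" where
  "nonsingular M Y X \<longleftrightarrow>
     (\<exists>ys xs. distinct ys \<and> set ys = Y \<and> distinct xs \<and> set xs = X \<and> length ys = length xs \<and>
        (\<forall>i<length xs. M (ys ! i) (xs ! i)) \<and>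
        (\<forall>j<length xs. \<forall>i<j. \<not> M (ys ! i) (xs ! j)))"

definition independent_columns :: "('r \<Rightarrow> 'a \<Rightarrow> bool) \<Rightarrow> 'r set \<Rightarrow> 'a set \<Rightarrow> bool" where
  "independent_columns M R X \<longleftrightarrow> (\<exists>Y\<subseteq>R. nonsingular M Y X)"

text \<open>
  Finite row sets are no restriction, as a matrix with finite column set \<^term>\<open>V\<close> has
  only finitely many distinct rows.
\<close>

definition BRSC :: "'a set \<Rightarrow> 'a set set \<Rightarrow> bool" where
  "BRSC V H \<longleftrightarrow> simplicial_complex V H \<and>
     (\<exists>(M :: nat \<Rightarrow> 'a \<Rightarrow> bool) m. \<forall>X\<subseteq>V. X \<in> H \<longleftrightarrow> independent_columns M {..<m} X)"

definition TBRSC :: "'a set \<Rightarrow> 'a set set \<Rightarrow> bool" where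
  "TBRSC V H \<longleftrightarrow> (\<exists>J k. BRSC V J \<and> k \<ge> 1 \<and> H = J \<inter> P\<^sub>\<le> k V)"

definition B2 :: "'a set \<Rightarrow> 'a set \<Rightarrow> 'a set set" where
  "B2 V L = P\<^sub>\<le> 2 V \<union> {X \<in> P\<^sub>= 3 V. card (X \<inter> L) = 2}"

definition complex_sum :: "'a set set \<Rightarrow> 'a set set \<Rightarrow> 'a set set"  (infixl \<open>\<boxplus>\<close> 65) where
  "H \<boxplus> H' = {I \<union> I' | I I'. I \<in> H \<and> I' \<in> H'}"


subsection \<open>Boolean representability by chains of flats\<close>

definition flat :: "'a set \<Rightarrow> 'a set set \<Rightarrow> 'a set \<Rightarrow> bool" where
  "flat V H F \<longleftrightarrow> F \<subseteq> V \<and> (\<forall>X\<in>H. X \<subseteq> F \<longrightarrow> (\<forall>p\<in>V - F. insert p X \<in> H))"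

definition flat_chain :: "'a set \<Rightarrow> 'a set set \<Rightarrow> 'a list \<Rightarrow> (nat \<Rightarrow> 'a set) \<Rightarrow> bool" where
  "flat_chain V H xs F \<longleftrightarrow> (\<forall>i\<le>length xs. flat V H (F i)) \<and>
     (\<forall>i<length xs. F i \<subset> F (Suc i) \<and> xs ! i \<in> F (Suc i) - F i)"

lemma nonsingular_rows_Nil: "nonsingular M {} {}"
  unfolding nonsingular_def by (rule exI[of _ "[]"], rule exI[of _ "[]"]) simp

lemma independent_insert:
  assumes "independent_columns M R X" "r \<in> R" "M r p" "\<forall>x\<in>X. \<not> M r x"
  shows "independent_columns M R (insert p X)"
proof -
  obtain ys xs where *: "distinct ys" "set ys \<subseteq> R" "distinct xs" "set xs = X"
      "length ys = length xs" "\<forall>i<length xs. M (ys ! i) (xs ! i)"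
      "\<forall>j<length xs. \<forall>i<j. \<not> M (ys ! i) (xs ! j)"
    using assms(1) unfolding independent_columns_def nonsingular_def by blast
  have "r \<notin> set ys"
    using * assms(4) by (metis in_set_conv_nth nth_mem)
  moreover have "p \<notin> X" using assms by blast
  moreover have "\<forall>i<length (p # xs). M ((r # ys) ! i) ((p # xs) ! i)"
    using * assms by (auto simp: nth_Cons split: nat.splits)
  moreover have "\<forall>j<length (p # xs). \<forall>i<j. \<not> M ((r # ys) ! i) ((p # xs) ! j)"
    using * assms by (auto simp: nth_Cons split: nat.splits)
  ultimately have "nonsingular M (set (r # ys)) (insert p X)"
    unfolding nonsingular_def using * by (intro exI[of _ "r # ys"] exI[of _ "p # xs"]) auto
  then show ?thesis
    unfolding independent_columns_def using * assms(2) by (intro exI[of _ "set (r # ys)"]) auto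
qed

lemma flat_Int:
  assumes "flat V H F" "flat V H G"
  shows "flat V H (F \<inter> G)"
  unfolding flat_def
proof (intro conjI ballI impI)
  show "F \<inter> G \<subseteq> V" using assms by (auto simp: flat_def)
next
  fix X p assume X: "X \<in> H" "X \<subseteq> F \<inter> G" and p: "p \<in> V - F \<inter> G"
  show "insert p X \<in> H"
    using X p assms by (cases "p \<in> F") (auto simp: flat_def)
qed

lemma flat_V: "flat V H V"
  unfolding flat_def by blast

lemma flat_INT:
  assumes "finite I" "\<forall>i\<in>I. flat V H (F i)"
  shows "flat V H (V \<inter> (\<Inter>i\<in>I. F i))"
  using assms
proof (induction I)
  case empty
  then show ?case by (simp add: flat_V)
next
  case (insert i I)
  have "V \<inter> (\<Inter>i\<in>insert i I. F i) = F i \<inter> (V \<inter> (\<Inter>i\<in>I. F i))" by auto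
  then show ?case using insert by (simp add: flat_Int)
qed

lemma flat_row:
  assumes rep: "\<forall>X\<subseteq>V. X \<in> H \<longleftrightarrow> independent_columns M R X" and "H \<subseteq> Pow V" "r \<in> R"
  shows "flat V H {x \<in> V. \<not> M r x}"
  unfolding flat_def
proof (intro conjI ballI impI)
  fix X p assume X: "X \<in> H" "X \<subseteq> {x \<in> V. \<not> M r x}" and p: "p \<in> V - {x \<in> V. \<not> M r x}"
  have "independent_columns M R (insert p X)"
    using rep X p assms by (intro independent_insert[of M R X r]) auto
  moreover have "insert p X \<subseteq> V" using X p by auto
  ultimately show "insert p X \<in> H" using rep by blast
qed auto

lemma BRSC_imp_flat_chain:
  assumes "BRSC V H" "X \<in> H"
  shows "\<exists>xs F. distinct xs \<and> set xs = X \<and> flat_chain V H xs F"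
proof -
  from assms(1) obtain M :: "nat \<Rightarrow> 'a \<Rightarrow> bool" and m
    where rep: "\<forall>X\<subseteq>V. X \<in> H \<longleftrightarrow> independent_columns M {..<m} X" and sub: "H \<subseteq> Pow V"
    unfolding BRSC_def simplicial_complex_def by (elim conjE exE) (rule that)
  then have XV: "X \<subseteq> V" using assms(2) by auto
  then have "independent_columns M {..<m} X" using rep assms(2) by simp
  then obtain ys xs where *: "set ys \<subseteq> {..<m}" "distinct xs" "set xs = X"
      "length ys = length xs" "\<forall>i<length xs. M (ys ! i) (xs ! i)"
      "\<forall>j<length xs. \<forall>i<j. \<not> M (ys ! i) (xs ! j)"
    unfolding independent_columns_def nonsingular_def by blast
  define n where "n = length xs"
  define F where "F k = V \<inter> (\<Inter>l\<in>{..<n - k}. {x \<in> V. \<not> M (ys ! l) x})" for k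
  have fl: "flat V H (F k)" for k
    unfolding F_def
  proof (intro flat_INT ballI)
    fix l assume "l \<in> {..<n - k}"
    then have "l < length ys" using *(4) by (simp add: n_def)
    then have "ys ! l \<in> {..<m}" using *(1) nth_mem by blast
    then show "flat V H {x \<in> V. \<not> M (ys ! l) x}" using flat_row[OF rep sub] by blast
  qed simp
  have mem: "rev xs ! i \<in> F (Suc i) - F i" if "i < n" for i
  proof -
    let ?j = "n - Suc i"
    have j: "?j < n" and r: "rev xs ! i = xs ! ?j"
      using that by (auto simp: n_def rev_nth)
    have V: "xs ! ?j \<in> V" using XV *(3) j nth_mem[of ?j xs] by (auto simp: n_def)
    have "\<forall>l<?j. \<not> M (ys ! l) (xs ! ?j)" using *(6) j unfolding n_def by blast
    then have "xs ! ?j \<in> F (Suc i)" using V by (auto simp: F_def)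
    moreover have "M (ys ! ?j) (xs ! ?j)" using *(5) j unfolding n_def by blast
    then have "xs ! ?j \<notin> F i"
      using that unfolding F_def by (auto intro!: bexI[of _ ?j])
    ultimately show ?thesis using r by simp
  qed
  have "F i \<subseteq> F (Suc i)" for i by (auto simp: F_def)
  then have "F i \<subset> F (Suc i)" if "i < n" for i using mem[OF that] by blast
  then have "flat_chain V H (rev xs) F"
    unfolding flat_chain_def using fl mem by (auto simp: n_def)
  then show ?thesis using * by (intro exI[of _ "rev xs"] exI[of _ F]) auto
qed

lemma flat_chain_imp_BRSC:
  assumes sc: "simplicial_complex V H"
    and ch: "\<forall>X\<in>H. \<exists>xs F. distinct xs \<and> set xs = X \<and> flat_chain V H xs F"
  shows "BRSC V H"
proof -
  have fin: "finite {F. flat V H F}"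
    using sc by (auto simp: flat_def simplicial_complex_def intro: finite_subset[of _ "Pow V"])
  then obtain m and f :: "nat \<Rightarrow> 'a set" where f: "{F. flat V H F} = f ` {i. i < m}"
    using finite_imp_nat_seg_image_inj_on[of "{F. flat V H F}"] by auto
  define M where "M i x \<longleftrightarrow> x \<notin> f i" for i x
  have E: "{} \<in> H" using sc by (auto simp: simplicial_complex_def)
  have 1: "independent_columns M {..<m} (set (take k xs))"
    if "flat_chain V H xs F" "k \<le> length xs" for k xs F
    using that(2)
  proof (induction k)
    case 0
    then show ?case using nonsingular_rows_Nil by (auto simp: independent_columns_def)
  next
    case (Suc k)
    then have k: "k < length xs" by simp
    have mono: "F i \<subseteq> F j" if "i \<le> j" "j \<le> length xs" for i j
      using that
    proof (induction j)
      case (Suc j)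
      have "F j \<subseteq> F (Suc j)"
        using Suc.prems \<open>flat_chain V H xs F\<close> unfolding flat_chain_def
        by (meson Suc_le_lessD psubset_imp_subset)
      then show ?case using Suc by (cases "i = Suc j") auto
    qed simp
    have "flat V H (F k)" using k \<open>flat_chain V H xs F\<close> by (simp add: flat_chain_def)
    then have "F k \<in> f ` {i. i < m}" using f by blast
    then obtain r where r: "r < m" "f r = F k" by auto
    have "\<forall>x\<in>set (take k xs). x \<in> F k"
    proof
      fix x assume "x \<in> set (take k xs)"
      then obtain i where "i < k" "x = xs ! i" using k by (auto simp: in_set_conv_nth)
      then show "x \<in> F k"
        using mono[of "Suc i" k] k \<open>flat_chain V H xs F\<close> by (auto simp: flat_chain_def)
    qed
    moreover have "xs ! k \<notin> F k" using k \<open>flat_chain V H xs F\<close> by (auto simp: flat_chain_def)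
    ultimately have "independent_columns M {..<m} (insert (xs ! k) (set (take k xs)))"
      using independent_insert[of M "{..<m}" "set (take k xs)" r "xs ! k"] Suc.IH k r
      by (simp add: M_def[of r])
    then show ?case using k by (simp add: take_Suc_conv_app_nth)
  qed
  have 2: "set xs \<in> H"
    if "length ys = length xs" "set ys \<subseteq> {..<m}" "set xs \<subseteq> V"
      "\<forall>i<length xs. M (ys ! i) (xs ! i)" "\<forall>j<length xs. \<forall>i<j. \<not> M (ys ! i) (xs ! j)" for ys xs
    using that
  proof (induction ys xs rule: list_induct2)
    case Nil
    then show ?case using E by simp
  next
    case (Cons y ys x xs)
    have a: "\<forall>i<length xs. M (ys ! i) (xs ! i)" using Cons.prems(3) by fastforce
    have b: "\<forall>j<length xs. \<forall>i<j. \<not> M (ys ! i) (xs ! j)" using Cons.prems(4) by fastforce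
    have H: "set xs \<in> H" using Cons a b by simp
    have "f y \<in> f ` {i. i < m}" using Cons.prems(1) by auto
    then have "flat V H (f y)" using f by blast
    moreover have "x \<notin> f y" using Cons.prems(3) by (auto simp: M_def)
    moreover have "set xs \<subseteq> f y"
    proof
      fix z assume "z \<in> set xs"
      then obtain j where "j < length xs" "z = xs ! j" by (auto simp: in_set_conv_nth)
      then show "z \<in> f y"
        using Cons.prems(4)[rule_format, of "Suc j" 0] by (simp add: M_def)
    qed
    ultimately show ?case using H Cons.prems by (auto simp: flat_def)
  qed
  have "X \<in> H \<longleftrightarrow> independent_columns M {..<m} X" if "X \<subseteq> V" for X
  proof
    assume "X \<in> H"
    then obtain xs F where "set xs = X" "flat_chain V H xs F" using ch by blast
    then show "independent_columns M {..<m} X" using 1[of xs F "length xs"] by simp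
  next
    assume "independent_columns M {..<m} X"
    then obtain ys xs where "set ys \<subseteq> {..<m}" "set xs = X" "length ys = length xs"
      "\<forall>i<length xs. M (ys ! i) (xs ! i)" "\<forall>j<length xs. \<forall>i<j. \<not> M (ys ! i) (xs ! j)"
      unfolding independent_columns_def nonsingular_def by blast
    then show "X \<in> H" using 2[of ys xs] that by simp
  qed
  then show ?thesis using sc unfolding BRSC_def by blast
qed

theorem BRSC_iff_flat_chain:
  "BRSC V H \<longleftrightarrow> simplicial_complex V H \<and>
     (\<forall>X\<in>H. \<exists>xs F. distinct xs \<and> set xs = X \<and> flat_chain V H xs F)"
proof
  assume B: "BRSC V H"
  then have "simplicial_complex V H" unfolding BRSC_def by (rule conjunct1)
  with BRSC_imp_flat_chain[OF B] show "simplicial_complex V H \<and>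
     (\<forall>X\<in>H. \<exists>xs F. distinct xs \<and> set xs = X \<and> flat_chain V H xs F)" by simp
next
  assume "simplicial_complex V H \<and>
     (\<forall>X\<in>H. \<exists>xs F. distinct xs \<and> set xs = X \<and> flat_chain V H xs F)"
  then show "BRSC V H" by (elim conjE) (rule flat_chain_imp_BRSC)
qed

end

theory Submission
  imports Defs
begin

text \<open>
  Call a set separated by a flat if the flat contains all but exactly one of its points. A complex is
  boolean representable iff each of its nonempty faces is separated by a flat.

  In the sum all sets of at most four points are faces, and no face has more than six points.
  Faces of at most five points are separated by one of their own facets. A six point face
  is determined by how many points it has in \<open>L - L'\<close>, \<open>L' - L\<close>, \<open>L \<inter> L'\<close> and outside
  \<open>L \<union> L'\<close>. It is separated by \<open>L\<close>, by \<open>L'\<close>, by \<open>L \<inter> L'\<close> with one point added, or by one of its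
  own facets, except possibly when it has three points in both \<open>L - L'\<close> and \<open>L' - L\<close>. In that case
  the facet with all three points of \<open>L - L'\<close> is a flat iff \<open>L - L'\<close> has no further point.
  If both differences have a fourth point, then such a face refutes representability, also of any
  complex that truncates to the sum.
\<close>

section \<open>Separation by flats\<close>

lemma flat_chain_mono:
  assumes "flat_chain V H xs F" "i \<le> j" "j \<le> length xs"
  shows "F i \<subseteq> F j"
  using assms(2,3)
proof (induction j)
  case (Suc j)
  have "F j \<subset> F (Suc j)"
    using Suc.prems assms(1) by (simp add: flat_chain_def)
  then show ?case using Suc by (cases "i = Suc j") auto
qed simp

text \<open>The last flat but one in a chain for \<open>X\<close> contains every point of
  \<open>X\<close> except the one enumerated last.\<close>

lemma BRSC_imp_separating_flat:
  assumes "BRSC V H" "X \<in> H" "X \<noteq> {}"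
  obtains x F where "x \<in> X" "flat V H F" "X \<inter> F = X - {x}"
proof -
  obtain xs F where xs: "distinct xs" "set xs = X" "flat_chain V H xs F"
    using BRSC_imp_flat_chain assms(1,2) by blast
  define n where "n = length xs - 1"
  have n: "length xs = Suc n" using xs(2) assms(3) by (cases xs) (auto simp: n_def)
  have "flat V H (F n)" using xs(3) n by (simp add: flat_chain_def)
  moreover have "xs ! n \<in> X" using xs(2) n by auto
  moreover have "xs ! n \<notin> F n" using xs(3) n by (simp add: flat_chain_def)
  moreover have "X - {xs ! n} \<subseteq> F n"
  proof
    fix x assume x: "x \<in> X - {xs ! n}"
    then obtain i where i: "i < length xs" "x = xs ! i" using xs(2) by (auto simp: in_set_conv_nth)
    then have "i < n" using x n by (cases "i = n") auto
    then show "x \<in> F n"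
      using flat_chain_mono[OF xs(3), of "Suc i" n] xs(3) i n by (auto simp: flat_chain_def)
  qed
  ultimately show thesis by (intro that) auto
qed

text \<open>Induction on the size of \<open>X\<close>: the separated point is enumerated last, after
  a chain for the other points. This works because flats are closed under intersection.\<close>

lemma BRSC_if_separating_flats:
  assumes sc: "simplicial_complex V H"
    and sep: "\<And>X. X \<in> H \<Longrightarrow> X \<noteq> {} \<Longrightarrow> \<exists>x\<in>X. \<exists>F. flat V H F \<and> X \<inter> F = X - {x}"
  shows "BRSC V H"
proof (rule flat_chain_imp_BRSC[OF sc], rule ballI)
  fix X assume "X \<in> H"
  moreover have "finite X" if "X \<in> H" for X
    using sc that finite_subset by (auto simp: simplicial_complex_def)
  ultimately show "\<exists>xs F. distinct xs \<and> set xs = X \<and> flat_chain V H xs F"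
  proof (induction "card X" arbitrary: X)
    case 0
    then have "X = {}" by simp
    then have "distinct [] \<and> set [] = X \<and> flat_chain V H [] (\<lambda>_. V)"
      by (simp add: flat_chain_def flat_V)
    then show ?case by blast
  next
    case (Suc n)
    then have "X \<noteq> {}" by auto
    then obtain x G where x: "x \<in> X" "flat V H G" "X \<inter> G = X - {x}" using sep Suc by blast
    have "X - {x} \<in> H" using sc \<open>X \<in> H\<close> unfolding simplicial_complex_def by blast
    moreover have "n = card (X - {x})" using Suc x by simp
    ultimately obtain xs F where xs: "distinct xs" "set xs = X - {x}" "flat_chain V H xs F"
      using Suc.hyps(1) Suc.prems(2) by blast
    \<comment> \<open>Cutting the old chain down to \<open>G\<close> makes its last flat avoid
      \<open>x\<close>. It stays strict since \<open>G\<close> contains all of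
      \<open>X - {x}\<close>. The new top is \<open>V\<close>.\<close>
    define F' where "F' i = (if i \<le> length xs then F i \<inter> G else V)" for i
    have "flat V H (F' i)" if "i \<le> length (xs @ [x])" for i
      using that xs(3) x(2) by (auto simp: F'_def flat_chain_def flat_Int flat_V)
    moreover have "F' i \<subset> F' (Suc i) \<and> (xs @ [x]) ! i \<in> F' (Suc i) - F' i"
      if "i < length (xs @ [x])" for i
    proof (cases "i < length xs")
      case True
      then have "xs ! i \<in> X - {x}" using xs(2) nth_mem by blast
      then have "xs ! i \<in> G" using x(3) by blast
      then show ?thesis using True xs(3) by (auto simp: F'_def flat_chain_def nth_append)
    next
      case False
      then have i: "i = length xs" using that by simp
      have "x \<in> V" using x(1) \<open>X \<in> H\<close> sc by (auto simp: simplicial_complex_def)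
      moreover have "x \<notin> G" using x by blast
      moreover have "G \<subseteq> V" using x(2) by (simp add: flat_def)
      ultimately show ?thesis by (auto simp: F'_def i)
    qed
    ultimately have "flat_chain V H (xs @ [x]) F'" by (simp add: flat_chain_def)
    moreover have "distinct (xs @ [x])" "set (xs @ [x]) = X" using xs x by auto
    ultimately show ?case by blast
  qed
qed

lemma BRSC_imp_TBRSC:
  assumes "BRSC V H" shows "TBRSC V H"
proof -
  have "finite V" "H \<subseteq> Pow V" using assms by (auto simp: BRSC_def simplicial_complex_def)
  \<comment> \<open>Truncation at this height removes nothing; the \<open>Suc\<close> keeps the
    bound positive when \<open>V\<close> is empty.\<close>
  then have "H = H \<inter> P\<^sub>\<le> (Suc (card V)) V"
    by (auto simp: subsets_le_def card_mono le_SucI)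
  then show ?thesis unfolding TBRSC_def using assms by (intro exI[of _ H] exI[of _ "Suc (card V)"]) simp
qed

lemma complex_sum_commute: "H \<boxplus> H' = H' \<boxplus> H"
  unfolding complex_sum_def by blast


section \<open>Faces of the sum\<close>

text \<open>The assumptions are symmetric in \<open>L\<close> and \<open>L'\<close>, so interpreting
  the locale with both exchanged yields the mirror image of each result.\<close>

locale B2_sum =
  fixes V L L' :: "'a set"
  assumes finite_V: "finite V" and L_sub: "L \<subseteq> V" and L'_sub: "L' \<subseteq> V"
begin

definition H :: "'a set set" where "H = B2 V L \<boxplus> B2 V L'"

definition nA :: "'a set \<Rightarrow> nat" where "nA X = card (X \<inter> (L - L'))"
definition nB :: "'a set \<Rightarrow> nat" where "nB X = card (X \<inter> (L' - L))"
definition nC :: "'a set \<Rightarrow> nat" where "nC X = card (X \<inter> (L \<inter> L'))"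
definition nD :: "'a set \<Rightarrow> nat" where "nD X = card (X - (L \<union> L'))"

lemmas n_defs = nA_def nB_def nC_def nD_def

lemma finite_sub: "X \<subseteq> V \<Longrightarrow> finite X"
  using finite_V finite_subset by blast

lemma card_Int_L: "finite X \<Longrightarrow> card (X \<inter> L) = nA X + nC X"
  unfolding n_defs by (subst card_Un_disjoint[symmetric]) (auto intro: arg_cong[where f = card])

lemma card_Int_L': "finite X \<Longrightarrow> card (X \<inter> L') = nB X + nC X"
  unfolding n_defs by (subst card_Un_disjoint[symmetric]) (auto intro: arg_cong[where f = card])

lemma card_diff_L: "finite X \<Longrightarrow> card (X - L) = nB X + nD X"
  unfolding n_defs by (subst card_Un_disjoint[symmetric]) (auto intro: arg_cong[where f = card])

lemma card_diff_L': "finite X \<Longrightarrow> card (X - L') = nA X + nD X"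
  unfolding n_defs by (subst card_Un_disjoint[symmetric]) (auto intro: arg_cong[where f = card])

lemma card_eq_counts: "finite X \<Longrightarrow> card X = nA X + nB X + nC X + nD X"
  using card_Int_Diff[of X L] card_Int_L[of X] card_diff_L[of X] by simp

lemma counts_Un:
  assumes "finite X" "finite Y" "X \<inter> Y = {}"
  shows "nA (X \<union> Y) = nA X + nA Y" "nB (X \<union> Y) = nB X + nB Y"
    "nC (X \<union> Y) = nC X + nC Y" "nD (X \<union> Y) = nD X + nD Y"
  unfolding n_defs Int_Un_distrib2 Un_Diff
  using assms by (auto intro!: card_Un_disjoint)

lemma counts_insert:
  assumes "finite X" "p \<notin> X"
  shows "nA (insert p X) = nA X + (if p \<in> L - L' then 1 else 0)"
    "nB (insert p X) = nB X + (if p \<in> L' - L then 1 else 0)"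
    "nC (insert p X) = nC X + (if p \<in> L \<inter> L' then 1 else 0)"
    "nD (insert p X) = nD X + (if p \<notin> L \<union> L' then 1 else 0)"
  unfolding n_defs using assms by (auto simp: Int_insert_left insert_Diff_if)

lemma B2_sub: "I \<in> B2 V L \<Longrightarrow> I \<subseteq> V" "I \<in> B2 V L' \<Longrightarrow> I \<subseteq> V"
  by (auto simp: B2_def subsets_le_def subsets_eq_def)

text \<open>A proper subset of a set with at most three points has at most two, and all such sets
  are faces.\<close>

lemma B2_down:
  assumes "I \<in> B2 V M" "J \<subseteq> I" shows "J \<in> B2 V M"
proof -
  have I: "I \<subseteq> V" "card I \<le> 3" using assms(1) by (auto simp: B2_def subsets_le_def subsets_eq_def)
  then have fin: "finite I" using finite_sub by blast
  show ?thesis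
  proof (cases "J = I")
    case False
    then have "card J < card I" using assms(2) fin by (simp add: psubset_card_mono psubset_eq)
    then show ?thesis using I assms(2) by (auto simp: B2_def subsets_le_def)
  qed (use assms in simp)
qed

lemma B2_card_le2: "I \<subseteq> V \<Longrightarrow> card I \<le> 2 \<Longrightarrow> I \<in> B2 V M"
  by (simp add: B2_def subsets_le_def)

lemma B2_card3: "card I = 3 \<Longrightarrow> I \<in> B2 V M \<longleftrightarrow> I \<subseteq> V \<and> card (I \<inter> M) = 2"
  by (auto simp: B2_def subsets_le_def subsets_eq_def)

lemma B2_card_le3: "I \<in> B2 V M \<Longrightarrow> card I \<le> 3"
  by (auto simp: B2_def subsets_le_def subsets_eq_def)

lemma H_sub: "X \<in> H \<Longrightarrow> X \<subseteq> V"
  using B2_sub by (auto simp: H_def complex_sum_def)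

lemma H_down:
  assumes "X \<in> H" "Y \<subseteq> X" shows "Y \<in> H"
proof -
  obtain I I' where I: "X = I \<union> I'" "I \<in> B2 V L" "I' \<in> B2 V L'"
    using assms(1) by (auto simp: H_def complex_sum_def)
  have "I \<inter> Y \<in> B2 V L" "I' \<inter> Y \<in> B2 V L'" using I B2_down by blast+
  moreover have "Y = (I \<inter> Y) \<union> (I' \<inter> Y)" using I(1) assms(2) by blast
  ultimately show ?thesis unfolding H_def complex_sum_def by blast
qed

text \<open>The second summand can be shrunk to \<open>I' - I\<close>. Disjointness makes the counts
  of the two summands add up.\<close>

lemma H_disjointE:
  assumes "X \<in> H"
  obtains I I' where "X = I \<union> I'" "I \<inter> I' = {}" "I \<in> B2 V L" "I' \<in> B2 V L'"
proof -
  obtain I I' where I: "X = I \<union> I'" "I \<in> B2 V L" "I' \<in> B2 V L'"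
    using assms(1) by (auto simp: H_def complex_sum_def)
  show thesis
    by (rule that[of I "I' - I"]) (use I B2_down[of I' L' "I' - I"] in auto)
qed

lemma H_I: "I \<in> B2 V L \<Longrightarrow> I' \<in> B2 V L' \<Longrightarrow> I \<union> I' \<in> H"
  unfolding H_def complex_sum_def by blast

lemma H_card:
  assumes "X \<in> H" shows "card X \<le> 6"
proof -
  obtain I I' where I: "X = I \<union> I'" "I \<in> B2 V L" "I' \<in> B2 V L'"
    using assms by (rule H_disjointE)
  then show ?thesis using card_Un_le[of I I'] B2_card_le3[of I L] B2_card_le3[of I' L'] by simp
qed

lemma H_card_le4:
  assumes "X \<subseteq> V" "card X \<le> 4" shows "X \<in> H"
proof -
  have fin: "finite X" using assms finite_sub by blast
  \<comment> \<open>A split into two sets of at most two points each; \<open>min\<close> covers sets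
    with fewer than two points.\<close>
  obtain I where I: "I \<subseteq> X" "card I = min 2 (card X)"
    using obtain_subset_with_card_n[of "min 2 (card X)" X] by auto
  have "card (X - I) \<le> 2" using card_Diff_subset[OF finite_subset[OF I(1) fin] I(1)] I assms by simp
  then have "I \<union> (X - I) \<in> H" using I assms by (intro H_I B2_card_le2) auto
  moreover have "I \<union> (X - I) = X" using I by blast
  ultimately show ?thesis by simp
qed

lemma simplicial_complex_H: "simplicial_complex V H"
  unfolding simplicial_complex_def
proof (intro conjI)
  show "P\<^sub>= 1 V \<subseteq> H" using H_card_le4 by (auto simp: subsets_eq_def)
  show "H \<noteq> {}" using H_card_le4[of "{}"] by auto
qed (use finite_V H_sub H_down in auto)

section \<open>Faces with five and six points\<close>

lemma B2_triple_exists: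
  assumes "finite X" "card (X \<inter> M) \<ge> 2" "X - M \<noteq> {}"
  obtains I where "I \<subseteq> X" "card I = 3" "card (I \<inter> M) = 2"
proof -
  obtain J where J: "J \<subseteq> X \<inter> M" "card J = 2" "finite J"
    using obtain_subset_with_card_n[OF assms(2)] by blast
  obtain x where x: "x \<in> X" "x \<notin> M" using assms(3) by blast
  have "insert x J \<inter> M = J" "x \<notin> J" using J x by auto
  then show thesis using J x by (intro that[of "insert x J"]) auto
qed

text \<open>The condition provides a triple that is a face of one summand; the remaining pair is a
  face of the other.\<close>

lemma face5_if:
  assumes "X \<subseteq> V" "card X = 5"
    and "card (X \<inter> L) \<ge> 2 \<and> X - L \<noteq> {} \<or> card (X \<inter> L') \<ge> 2 \<and> X - L' \<noteq> {}"
  shows "X \<in> H"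
proof -
  have fin: "finite X" using assms finite_sub by blast
  consider "card (X \<inter> L) \<ge> 2" "X - L \<noteq> {}" | "card (X \<inter> L') \<ge> 2" "X - L' \<noteq> {}"
    using assms(3) by blast
  then show ?thesis
  proof cases
    case 1
    obtain I where I: "I \<subseteq> X" "card I = 3" "card (I \<inter> L) = 2"
      using B2_triple_exists[OF fin 1] by blast
    have "card (X - I) = 2" using I fin assms(2) by (simp add: card_Diff_subset finite_subset)
    then have "I \<union> (X - I) \<in> H" using I assms(1) by (intro H_I) (auto simp: B2_card3 intro: B2_card_le2)
    moreover have "I \<union> (X - I) = X" using I by blast
    ultimately show ?thesis by simp
  next
    case 2
    obtain I where I: "I \<subseteq> X" "card I = 3" "card (I \<inter> L') = 2"
      using B2_triple_exists[OF fin 2] by blast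
    have "card (X - I) = 2" using I fin assms(2) by (simp add: card_Diff_subset finite_subset)
    then have "(X - I) \<union> I \<in> H" using I assms(1) by (intro H_I) (auto simp: B2_card3 intro: B2_card_le2)
    moreover have "(X - I) \<union> I = X" using I by blast
    ultimately show ?thesis by simp
  qed
qed

text \<open>Two pairs cover only four points, so one summand contributes a triple with two points in
  its set and one outside.\<close>

lemma face5D:
  assumes "X \<in> H" "card X = 5"
  shows "card (X \<inter> L) \<ge> 2 \<and> X - L \<noteq> {} \<or> card (X \<inter> L') \<ge> 2 \<and> X - L' \<noteq> {}"
proof -
  obtain I I' where I: "X = I \<union> I'" "I \<in> B2 V L" "I' \<in> B2 V L'"
    using assms by (rule_tac H_disjointE)
  have fin: "finite X" using assms finite_sub H_sub by blast
  have *: "card (X \<inter> M) \<ge> 2 \<and> X - M \<noteq> {}" if "K \<in> B2 V M" "card K = 3" "K \<subseteq> X" for K M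
  proof -
    have K: "card (K \<inter> M) = 2" using that B2_card3 by blast
    then have "K - M \<noteq> {}" using that(2) by (metis Diff_eq_empty_iff Int_absorb2 numeral_eq_iff semiring_norm(88))
    moreover have "card (K \<inter> M) \<le> card (X \<inter> M)" using that fin by (intro card_mono) auto
    ultimately show ?thesis using K that by auto
  qed
  have "card I = 3 \<or> card I' = 3"
    using card_Un_le[of I I'] B2_card_le3[OF I(2)] B2_card_le3[OF I(3)] assms(2) I(1) by auto
  then show ?thesis using *[OF I(2)] *[OF I(3)] I(1) by blast
qed

text \<open>
  The numbers of points of a six point face \<open>I \<union> I'\<close> in \<open>L - L'\<close>, \<open>L' - L\<close> and outside \<open>L \<union> L'\<close>:
  they are \<open>i + x\<close>, \<open>j + y\<close> and \<open>(1 - x) + (1 - y)\<close>, where \<open>i, j \<le> 2\<close> and \<open>x, y \<le> 1\<close>. Here \<open>I\<close> has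
  \<open>i\<close> points in \<open>L - L'\<close> and \<open>y\<close> in \<open>L' - L\<close>, while \<open>I'\<close> has \<open>x\<close> and \<open>j\<close>.
\<close>

definition good6 :: "nat \<Rightarrow> nat \<Rightarrow> nat \<Rightarrow> bool" where
  "good6 a b d \<longleftrightarrow> a \<le> 3 \<and> b \<le> 3 \<and> d \<le> 2 \<and> (d = 0 \<longrightarrow> 1 \<le> a \<and> 1 \<le> b) \<and>
     (d = 1 \<longrightarrow> 1 \<le> a \<and> b \<le> 2 \<or> a \<le> 2 \<and> 1 \<le> b) \<and> (d = 2 \<longrightarrow> a \<le> 2 \<and> b \<le> 2)"

text \<open>The chosen numbers are the counts of \<open>I\<close>, the differences those of
  \<open>I'\<close>. The equations say that \<open>I\<close> has two points in \<open>L\<close> and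
  one outside, and \<open>I'\<close> likewise for \<open>L'\<close>.\<close>

lemma good6_split:
  assumes "good6 a b d" "a + b + c + d = 6"
  obtains (split) ia ib ic id where "ia \<le> a" "ib \<le> b" "ic \<le> c" "id \<le> d"
    "ia + ic = 2" "ib + id = 1" "(b - ib) + (c - ic) = 2" "(a - ia) + (d - id) = 1"
proof -
  have *: thesis if "a = i + x" "b = j + y" "d = (1 - x) + (1 - y)" "i \<le> 2" "j \<le> 2"
      "x \<le> 1" "y \<le> 1" for i j x y
    using that assms(2) by (intro split[of i y "2 - i" "1 - y"]) auto
  consider "d = 2" "a \<le> 2" "b \<le> 2" | "d = 1" "1 \<le> a" "a \<le> 3" "b \<le> 2"
    | "d = 1" "a \<le> 2" "1 \<le> b" "b \<le> 3" | "d = 0" "1 \<le> a" "a \<le> 3" "1 \<le> b" "b \<le> 3"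
    using assms(1) unfolding good6_def by linarith
  then show thesis
  proof cases
    case 1 then show ?thesis by (intro *[of a 0 b 0]) auto
  next
    case 2 then show ?thesis by (intro *[of "a - 1" 1 b 0]) auto
  next
    case 3 then show ?thesis by (intro *[of a 0 "b - 1" 1]) auto
  next
    case 4 then show ?thesis by (intro *[of "a - 1" 1 "b - 1" 1]) auto
  qed
qed

text \<open>Here \<open>a\<close>, \<open>b\<close>, \<open>1\<close> are the counts of a facet
  missing a point outside \<open>L \<union> L'\<close>. The conclusions serve to show it flat: they
  are the types after adding a point of \<open>L - L'\<close>, \<open>L' - L\<close> or
  \<open>L \<inter> L'\<close>. The last one fails for \<open>a = b = 0\<close>.\<close>

lemma good6_remove_D:
  assumes "good6 a b 2" "a + b > 0"
  shows "good6 (Suc a) b 1" "good6 a (Suc b) 1" "good6 a b 1"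
  using assms by (auto simp: good6_def)

text \<open>The analogue for a facet missing a point of \<open>L' - L\<close>, the difference met at
  least as often. The exception \<open>a = 3\<close> forces \<open>Suc b = 3\<close> and
  \<open>d = 0\<close>, the critical type.\<close>

lemma good6_remove_B:
  assumes "good6 a (Suc b) d" "d \<le> 1" "a + d \<ge> 2" "Suc b + d \<ge> 2" "a \<le> Suc b"
  shows "good6 (Suc a) b d \<or> a = 3" "good6 a b d" "good6 a b (Suc d)"
proof -
  have "a = 0 \<or> a = 1 \<or> a = 2 \<or> a = 3" "b = 0 \<or> b = 1 \<or> b = 2" "d = 0 \<or> d = 1"
    using assms(1,2) by (auto simp: good6_def)
  then show "good6 (Suc a) b d \<or> a = 3" "good6 a b d" "good6 a b (Suc d)"
    using assms by (elim disjE; simp add: good6_def)+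
qed

lemma good6_commute: "good6 a b d \<longleftrightarrow> good6 b a d"
  by (auto simp: good6_def)

text \<open>Six points require two disjoint triples, whose counts satisfy linear equations.
  Conversely, any subset \<open>I\<close> with the counts from \<open>good6_split\<close> gives such
  a decomposition.\<close>

lemma face6_iff:
  assumes "X \<subseteq> V" "card X = 6"
  shows "X \<in> H \<longleftrightarrow> good6 (nA X) (nB X) (nD X)"
proof
  have fin: "finite X" using assms finite_sub by blast
  assume "X \<in> H"
  then obtain I I' where I: "X = I \<union> I'" "I \<inter> I' = {}" "I \<in> B2 V L" "I' \<in> B2 V L'"
    by (rule H_disjointE)
  have f: "finite I" "finite I'" using fin I(1) by auto
  have c: "card I = 3" "card I' = 3"
    using card_Un_disjoint[OF f I(2)] B2_card_le3[OF I(3)] B2_card_le3[OF I(4)] assms(2) I(1) by auto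
  have "nA I + nC I = 2" "nB I' + nC I' = 2"
    using I c B2_card3 card_Int_L[OF f(1)] card_Int_L'[OF f(2)] by auto
  moreover have "nA I + nB I + nC I + nD I = 3" "nA I' + nB I' + nC I' + nD I' = 3"
    using c card_eq_counts f by auto
  moreover have "nA X = nA I + nA I'" "nB X = nB I + nB I'" "nD X = nD I + nD I'"
    using counts_Un[OF f I(2)] I(1) by auto
  ultimately show "good6 (nA X) (nB X) (nD X)"
    unfolding good6_def by (cases "nD I = 0"; intro conjI impI; linarith)
next
  have fin: "finite X" using assms finite_sub by blast
  assume "good6 (nA X) (nB X) (nD X)"
  moreover have "nA X + nB X + nC X + nD X = 6" using card_eq_counts[OF fin] assms(2) by simp
  ultimately obtain ia ib ic id where i: "ia \<le> nA X" "ib \<le> nB X" "ic \<le> nC X" "id \<le> nD X"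
    "ia + ic = 2" "ib + id = 1" "(nB X - ib) + (nC X - ic) = 2" "(nA X - ia) + (nD X - id) = 1"
    by (rule good6_split)
  obtain SA SB SC SD where S: "SA \<subseteq> X \<inter> (L - L')" "card SA = ia" "SB \<subseteq> X \<inter> (L' - L)" "card SB = ib"
    "SC \<subseteq> X \<inter> (L \<inter> L')" "card SC = ic" "SD \<subseteq> X - (L \<union> L')" "card SD = id"
    using i(1-4) unfolding n_defs by (metis obtain_subset_with_card_n)
  define I where "I = SA \<union> SB \<union> SC \<union> SD"
  have IX: "I \<subseteq> X" using S by (auto simp: I_def)
  have fI: "finite I" "finite (X - I)" using IX fin finite_subset by auto
  have "I \<inter> (L - L') = SA" "I \<inter> (L' - L) = SB" "I \<inter> (L \<inter> L') = SC" "I - (L \<union> L') = SD"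
    using S unfolding I_def by blast+
  then have n: "nA I = ia" "nB I = ib" "nC I = ic" "nD I = id" using S by (auto simp: n_defs)
  have XI: "I \<union> (X - I) = X" "I \<inter> (X - I) = {}" using IX by auto
  have n': "nA X = nA I + nA (X - I)" "nB X = nB I + nB (X - I)"
    "nC X = nC I + nC (X - I)" "nD X = nD I + nD (X - I)"
    using counts_Un[OF fI XI(2)] unfolding XI(1) by auto
  have "card I = 3" "card (I \<inter> L) = 2" "card (X - I) = 3" "card ((X - I) \<inter> L') = 2"
    using card_eq_counts[OF fI(1)] card_eq_counts[OF fI(2)] card_Int_L[OF fI(1)] card_Int_L'[OF fI(2)]
      n n' i by auto
  then have "I \<union> (X - I) \<in> H" using IX assms(1) by (intro H_I) (auto simp: B2_card3)
  then show "X \<in> H" using XI by simp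
qed


section \<open>Flats of the sum\<close>

text \<open>No triple of \<open>B2 V L\<close> lies inside \<open>L\<close>, so the first summand of
  a face inside \<open>L\<close> has at most two points and can absorb any point outside
  \<open>L\<close>.\<close>

lemma flat_L: "flat V H L"
  unfolding flat_def
proof (intro conjI ballI impI L_sub)
  fix X p assume X: "X \<in> H" "X \<subseteq> L" and p: "p \<in> V - L"
  obtain I I' where I: "X = I \<union> I'" "I \<in> B2 V L" "I' \<in> B2 V L'"
    using X(1) by (rule H_disjointE)
  have fin: "finite I" using I(2) B2_sub finite_sub by blast
  have IL: "I \<inter> L = I" "insert p I \<inter> L = I" "p \<notin> I" using I X p by auto
  have "card I \<le> 2" using B2_card_le3[OF I(2)] I(2) B2_card3[of I L] IL by (cases "card I = 3") auto
  then have "insert p I \<in> B2 V L"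
    using IL fin I(2) B2_sub(1) p B2_card3[of "insert p I" L] B2_card_le2[of "insert p I" L]
    by (cases "card I = 2") auto
  then show "insert p X \<in> H" using H_I[OF _ I(3), of "insert p I"] I(1) by simp
qed

lemma flat_small:
  assumes "F \<subseteq> V" "card F \<le> 3" shows "flat V H F"
  unfolding flat_def
proof (intro conjI ballI impI assms(1))
  fix X p assume X: "X \<in> H" "X \<subseteq> F" and p: "p \<in> V - F"
  have "card X \<le> 3" using card_mono[OF finite_sub[OF assms(1)] X(2)] assms(2) by simp
  then have "card (insert p X) \<le> 4" using card_insert_le_m1 by (simp add: card_insert_if finite_sub[OF H_sub[OF X(1)]])
  then show "insert p X \<in> H" using X H_sub p by (intro H_card_le4) auto
qed

text \<open>As \<open>H\<close> is closed under subsets, only the largest subset of \<open>Y\<close>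
  needs testing.\<close>

lemma flat_if_insert_faces:
  assumes "Y \<subseteq> V" "\<And>p. p \<in> V - Y \<Longrightarrow> insert p Y \<in> H"
  shows "flat V H Y"
  unfolding flat_def using assms H_down by (meson insert_mono)

text \<open>The condition of \<open>face5_if\<close> survives the insertion of further
  points.\<close>

lemma flat4:
  assumes "Y \<subseteq> V" "card Y = 4"
    and "card (Y \<inter> L) \<ge> 2 \<and> Y - L \<noteq> {} \<or> card (Y \<inter> L') \<ge> 2 \<and> Y - L' \<noteq> {}"
  shows "flat V H Y"
proof (rule flat_if_insert_faces[OF assms(1)])
  fix p assume p: "p \<in> V - Y"
  have fin: "finite Y" using assms finite_sub by blast
  have "card (insert p Y \<inter> M) \<ge> card (Y \<inter> M)" for M using fin by (intro card_mono) auto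
  then have "card (insert p Y \<inter> L) \<ge> 2 \<and> insert p Y - L \<noteq> {}
      \<or> card (insert p Y \<inter> L') \<ge> 2 \<and> insert p Y - L' \<noteq> {}"
    using assms(3) by (meson Diff_eq_empty_iff insert_subset le_trans)
  then show "insert p Y \<in> H" using p fin assms by (intro face5_if) auto
qed

text \<open>The removed point comes from \<open>M\<close> if \<open>M\<close> contains at least
  three of the five, and otherwise from the three points outside \<open>M\<close>.\<close>

lemma facet_meets:
  assumes "finite X" "card X = 5" "card (X \<inter> M) \<ge> 2" "X - M \<noteq> {}"
  obtains x where "x \<in> X" "card ((X - {x}) \<inter> M) \<ge> 2" "(X - {x}) - M \<noteq> {}"
proof (cases "card (X \<inter> M) \<ge> 3")
  case True
  then obtain x where x: "x \<in> X \<inter> M" by (metis card.empty ex_in_conv not_numeral_le_zero)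
  have "(X - {x}) \<inter> M = X \<inter> M - {x}" by blast
  then have "card ((X - {x}) \<inter> M) = card (X \<inter> M) - 1" using x by simp
  moreover have "(X - {x}) - M = X - M" using x by blast
  ultimately show thesis using that[of x] x True assms(4) by auto
next
  case False
  then have c: "card (X - M) = 3" using card_Int_Diff[OF assms(1), of M] assms by simp
  obtain x where x: "x \<in> X - M" using assms(4) by blast
  have "(X - {x}) - M = X - M - {x}" by blast
  then have "card ((X - {x}) - M) = 2" using c x by simp
  then have "(X - {x}) - M \<noteq> {}" by (metis card.empty zero_neq_numeral)
  moreover have "(X - {x}) \<inter> M = X \<inter> M" using x by blast
  ultimately show thesis using that[of x] x assms(3) by auto
qed

lemma separate_le5:
  assumes "X \<in> H" "X \<noteq> {}" "card X \<le> 5"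
  shows "\<exists>x\<in>X. flat V H (X - {x})"
proof -
  have XV: "X \<subseteq> V" and fin: "finite X" using assms H_sub finite_sub by blast+
  show ?thesis
  proof (cases "card X = 5")
    case True
    obtain x where x: "x \<in> X" "card ((X - {x}) \<inter> L) \<ge> 2 \<and> (X - {x}) - L \<noteq> {}
        \<or> card ((X - {x}) \<inter> L') \<ge> 2 \<and> (X - {x}) - L' \<noteq> {}"
      using face5D[OF assms(1) True] facet_meets[OF fin True] by metis
    then have "flat V H (X - {x})" using XV True fin by (intro flat4) auto
    then show ?thesis using x by blast
  next
    case False
    obtain x where x: "x \<in> X" using assms(2) by blast
    then have "flat V H (X - {x})" using XV False assms(3) fin by (intro flat_small) auto
    then show ?thesis using x by blast
  qed
qed

text \<open>This flat separates the faces with four points in \<open>L \<inter> L'\<close> and two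
  outside \<open>L \<union> L'\<close>.\<close>

lemma flat_common_insert:
  assumes d: "d \<in> V - (L \<union> L')"
  shows "flat V H (insert d (L \<inter> L'))"
  unfolding flat_def
proof (intro conjI ballI impI)
  show "insert d (L \<inter> L') \<subseteq> V" using d L_sub by auto
next
  fix X p assume X: "X \<in> H" "X \<subseteq> insert d (L \<inter> L')" and p: "p \<in> V - insert d (L \<inter> L')"
  have XV: "X \<subseteq> V" and fin: "finite X" using X H_sub finite_sub by blast+
  have pX: "p \<notin> X" using p X by blast
  have "X \<inter> (L - L') = {}" "X \<inter> (L' - L) = {}" "X - (L \<union> L') \<subseteq> {d}" using X d by auto
  then have n: "nA X = 0" "nB X = 0" "nD X \<le> 1"
    using card_mono[of "{d}" "X - (L \<union> L')"] by (auto simp: n_defs)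
  have cX: "card X = nC X + nD X" using card_eq_counts[OF fin] n by simp
  have ins: "insert p X \<subseteq> V" "card (insert p X) = Suc (card X)" using p XV fin pX by auto
  have "card X \<noteq> 6"
    using face6_iff[OF XV] X(1) n unfolding good6_def by (cases "nD X = 0") auto
  then consider "card X \<le> 3" | "card X = 4" | "card X = 5" using H_card[OF X(1)] by linarith
  then show "insert p X \<in> H"
  proof cases
    case 1 then show ?thesis using ins by (intro H_card_le4) auto
  next
    case 2
    have "card (insert p X \<inter> L) \<ge> 2" "card (insert p X \<inter> L') \<ge> 2"
      using 2 cX n card_Int_L[of "insert p X"] card_Int_L'[of "insert p X"] fin
      by (auto simp: counts_insert[OF fin pX])
    moreover have "insert p X - L \<noteq> {} \<or> insert p X - L' \<noteq> {}" using p by auto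
    ultimately show ?thesis using ins 2 by (intro face5_if) auto
  next
    case 3
    \<comment> \<open>A five point face cannot lie inside both \<open>L\<close> and
      \<open>L'\<close>, so it contains \<open>d\<close>. Since \<open>p\<close> is not in
      \<open>L \<inter> L'\<close>, each possible position of \<open>p\<close> then gives a good
      type.\<close>
    have "nD X = 1"
    proof (rule ccontr)
      assume "nD X \<noteq> 1"
      then have "nD X = 0" using n by simp
      then have "X - (L \<union> L') = {}" using fin by (simp only: nD_def card_0_eq finite_Diff)
      then show False using face5D[OF X(1) 3] X(2) d by auto
    qed
    then have "good6 (nA (insert p X)) (nB (insert p X)) (nD (insert p X))"
      using n p by (auto simp: counts_insert[OF fin pX] good6_def)
    then show ?thesis using face6_iff ins 3 by auto
  qed
qed

text \<open>One condition for each region of the added point; \<open>L - L' \<subseteq> Y\<close>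
  says that no point of \<open>L - L'\<close> is left to add.\<close>

lemma flat5:
  assumes Y: "Y \<subseteq> V" "card Y = 5"
    and A: "good6 (Suc (nA Y)) (nB Y) (nD Y) \<or> L - L' \<subseteq> Y"
    and B: "good6 (nA Y) (Suc (nB Y)) (nD Y)" and C: "good6 (nA Y) (nB Y) (nD Y)"
    and D: "good6 (nA Y) (nB Y) (Suc (nD Y))"
  shows "flat V H Y"
proof (rule flat_if_insert_faces[OF Y(1)])
  fix p assume p: "p \<in> V - Y"
  have fin: "finite Y" using Y finite_sub by blast
  have "good6 (nA (insert p Y)) (nB (insert p Y)) (nD (insert p Y))"
    using p A B C D by (auto simp: counts_insert[OF fin])
  then show "insert p Y \<in> H" using face6_iff[of "insert p Y"] p Y fin by auto
qed

end

lemma B2_sum_swap: "B2_sum V L L' \<Longrightarrow> B2_sum V L' L"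
  by (simp add: B2_sum_def)

context B2_sum
begin

lemma flat_L': "flat V H L'"
proof -
  interpret swap: B2_sum V L' L by (rule B2_sum_swap) unfold_locales
  show ?thesis using swap.flat_L by (simp add: swap.H_def H_def complex_sum_commute)
qed

section \<open>Separation of six point faces\<close>

lemma separate6:
  assumes A3: "card (L - L') \<le> 3" and X: "X \<in> H" "card X = 6"
  shows "\<exists>x\<in>X. \<exists>F. flat V H F \<and> X \<inter> F = X - {x}"
proof -
  have XV: "X \<subseteq> V" and fin: "finite X" using X H_sub finite_sub by blast+
  have g: "good6 (nA X) (nB X) (nD X)" using X XV face6_iff by blast
  have sum: "nA X + nB X + nC X + nD X = 6" using card_eq_counts[OF fin] X by simp
  have facet: ?thesis if "x \<in> X" "flat V H (X - {x})" for x using that by blast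
  have rem: "X - {x} \<subseteq> V" "card (X - {x}) = 5"
      "nA X = nA (X - {x}) + (if x \<in> L - L' then 1 else 0)"
      "nB X = nB (X - {x}) + (if x \<in> L' - L then 1 else 0)"
      "nD X = nD (X - {x}) + (if x \<notin> L \<union> L' then 1 else 0)" if "x \<in> X" for x
    using counts_insert[of "X - {x}" x] that fin XV X(2) by (auto simp: insert_absorb)
  have one: "\<exists>x\<in>X. X \<inter> M = X - {x}" if M: "card (X - M) = 1" for M
  proof -
    obtain x where "X - M = {x}" using card_1_singletonE[OF M] by blast
    then show ?thesis by blast
  qed
  have ge1: "nA X + nD X \<ge> 1" "nB X + nD X \<ge> 1" and le2: "nD X \<le> 2"
    using g by (auto simp: good6_def)
  \<comment> \<open>The separating flats are, in order: \<open>L\<close>, \<open>L'\<close>,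
    \<open>L \<inter> L'\<close> with one point added, and facets missing a point outside
    \<open>L \<union> L'\<close>, of \<open>L' - L\<close>, and of \<open>L - L'\<close>.\<close>
  consider (L) "nB X + nD X = 1" | (L') "nA X + nD X = 1"
    | (C) "nA X = 0" "nB X = 0" "nD X = 2"
    | (D) "nD X = 2" "nA X + nB X > 0"
    | (B) "nD X \<le> 1" "nA X + nD X \<ge> 2" "nB X + nD X \<ge> 2" "nA X \<le> nB X"
    | (A) "nD X \<le> 1" "nA X + nD X \<ge> 2" "nB X + nD X \<ge> 2" "nA X > nB X"
  proof (cases "nD X = 2")
    case True
    then show thesis using C D by (cases "nA X + nB X = 0") auto
  next
    case False
    then have "nD X \<le> 1" using le2 by simp
    moreover have "nA X + nD X = 1 \<or> nA X + nD X \<ge> 2" "nB X + nD X = 1 \<or> nB X + nD X \<ge> 2"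
      using ge1 by auto
    moreover have "nA X \<le> nB X \<or> nA X > nB X" by auto
    ultimately show thesis using L L' A B by blast
  qed
  then show ?thesis
  proof cases
    case L
    then show ?thesis using one[of L] card_diff_L[OF fin] flat_L by auto
  next
    case L'
    then show ?thesis using one[of L'] card_diff_L'[OF fin] flat_L' by auto
  next
    case C
    obtain x y where xy: "X - (L \<union> L') = {x, y}" "x \<noteq> y"
      using C(3) unfolding nD_def by (meson card_2_iff)
    have e: "X \<inter> (L - L') = {}" "X \<inter> (L' - L) = {}" using C fin by (auto simp: n_defs)
    have "flat V H (insert x (L \<inter> L'))" using xy XV by (intro flat_common_insert) auto
    moreover have "X \<inter> insert x (L \<inter> L') = X - {y}" using e xy by blast
    moreover have "y \<in> X" using xy by blast
    ultimately show ?thesis by blast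
  next
    case D
    then obtain x where x: "x \<in> X" "x \<notin> L \<union> L'" unfolding nD_def
      by (metis Diff_iff card.empty ex_in_conv zero_neq_numeral)
    have n: "nA X = nA (X - {x})" "nB X = nB (X - {x})" "nD (X - {x}) = 1"
      using rem[OF x(1)] x(2) D(1) by auto
    have "flat V H (X - {x})"
      using flat5[OF rem(1,2)[OF x(1)]] good6_remove_D[of "nA X" "nB X"] g D
      by (simp add: n numeral_2_eq_2)
    then show ?thesis using facet x by blast
  next
    case B
    then have "nB X > 0" using sum by linarith
    then obtain x where x: "x \<in> X" "x \<in> L' - L" unfolding nB_def
      by (metis Int_iff card.empty ex_in_conv less_irrefl)
    \<comment> \<open>The only use of the bound on \<open>L - L'\<close>: it settles the exception
      in \<open>good6_remove_B\<close>.\<close>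
    have AX: "L - L' \<subseteq> X - {x}" if "nA X = 3"
    proof -
      have "X \<inter> (L - L') = L - L'"
        using that A3 finite_sub[OF L_sub] unfolding nA_def by (intro card_seteq) auto
      then show ?thesis using x by blast
    qed
    have n: "nA X = nA (X - {x})" "nB X = Suc (nB (X - {x}))" "nD X = nD (X - {x})"
      using rem[OF x(1)] x(2) by auto
    have "flat V H (X - {x})"
      using flat5[OF rem(1,2)[OF x(1)]] AX g B good6_remove_B[of "nA X" "nB (X - {x})" "nD X"]
      unfolding n by blast
    then show ?thesis using facet x by blast
  next
    case A
    then have "nA X > 0" using sum by linarith
    then obtain x where x: "x \<in> X" "x \<in> L - L'" unfolding nA_def
      by (metis Int_iff card.empty ex_in_conv less_irrefl)
    have n: "nA X = Suc (nA (X - {x}))" "nB X = nB (X - {x})" "nD X = nD (X - {x})"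
      using rem[OF x(1)] x(2) by auto
    \<comment> \<open>With \<open>L\<close> and \<open>L'\<close> exchanged, the exception cannot
      occur because \<open>nB X < nA X \<le> 3\<close>.\<close>
    have "nB X \<noteq> 3" using g A(4) by (auto simp: good6_def)
    then have "flat V H (X - {x})"
      using flat5[OF rem(1,2)[OF x(1)]] g A less_imp_le[OF A(4)]
        good6_remove_B[of "nB X" "nA (X - {x})" "nD X"]
      unfolding n good6_commute[of "nB (X - {x})"] good6_commute[of "Suc (nB (X - {x}))"] by blast
    then show ?thesis using facet x by blast
  qed
qed

lemma BRSC_if_small_diff:
  assumes "card (L - L') \<le> 3" shows "BRSC V H"
proof (rule BRSC_if_separating_flats[OF simplicial_complex_H])
  fix X assume X: "X \<in> H" "X \<noteq> {}"
  show "\<exists>x\<in>X. \<exists>F. flat V H F \<and> X \<inter> F = X - {x}"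
  proof (cases "card X = 6")
    case True then show ?thesis using separate6 assms X by blast
  next
    case False
    then obtain x where "x \<in> X" "flat V H (X - {x})"
      using separate_le5 X H_card[OF X(1)] by force
    then show ?thesis by blast
  qed
qed

section \<open>The obstruction when both differences have at least four points\<close>

lemma counts_of_parts:
  assumes "S \<subseteq> L - L'" "T \<subseteq> L' - L"
  shows "nA (S \<union> T) = card S" "nB (S \<union> T) = card T" "nD (S \<union> T) = 0"
    "card (S \<union> T) = card S + card T"
proof -
  have "(S \<union> T) \<inter> (L - L') = S" "(S \<union> T) \<inter> (L' - L) = T" "(S \<union> T) - (L \<union> L') = {}"
    using assms by auto
  then show "nA (S \<union> T) = card S" "nB (S \<union> T) = card T" "nD (S \<union> T) = 0"
    by (simp_all only: n_defs card.empty)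
  show "card (S \<union> T) = card S + card T"
    using assms finite_sub L_sub L'_sub by (intro card_Un_disjoint) (auto intro: finite_subset)
qed

text \<open>
  The closure of a facet of the \<open>3 + 3\<close> face \<open>S \<union> T\<close>, with \<open>x\<close> missing from \<open>T\<close>, first picks up
  the fourth point \<open>a\<close>, as \<open>4 + 2\<close> sets are not faces, and then \<open>x\<close>, as \<open>insert a S\<close> together with
  one point of \<open>T\<close> is a face.
\<close>

lemma closure_contains_missing:
  assumes F: "\<And>Y p. Y \<in> H \<Longrightarrow> card Y = 5 \<Longrightarrow> Y \<subseteq> F \<Longrightarrow> p \<in> V - F \<Longrightarrow> insert p Y \<in> H"
    and S: "S \<subseteq> L - L'" "card S = 3" and T: "T \<subseteq> L' - L" "card T = 3"
    and a: "a \<in> (L - L') - S" and x: "x \<in> T" and sub: "S \<union> (T - {x}) \<subseteq> F"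
  shows "x \<in> F"
proof (rule ccontr)
  assume "x \<notin> F"
  have fin: "finite S" "finite T" using S T by (auto intro: card_ge_0_finite)
  have V: "L - L' \<subseteq> V" "L' - L \<subseteq> V" using L_sub L'_sub by auto
  have nonface: "S' \<union> T' \<notin> H" if "S' \<subseteq> L - L'" "T' \<subseteq> L' - L" "card S' = 4" "card T' = 2" for S' T'
    using that counts_of_parts[OF that(1,2)] face6_iff[of "S' \<union> T'"] V by (auto simp: good6_def)
  have face: "S' \<union> T' \<in> H"
    if "S' \<subseteq> L - L'" "T' \<subseteq> L' - L" "card S' \<ge> 2" "card T' \<ge> 1" "card S' + card T' = 5" for S' T'
  proof (rule face5_if)
    show "S' \<union> T' \<subseteq> V" using that V by blast
    show "card (S' \<union> T') = 5" using that counts_of_parts by simp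
    have "(S' \<union> T') \<inter> L = S'" using that by blast
    moreover have "(S' \<union> T') - L = T'" "T' \<noteq> {}" using that by auto
    ultimately show "2 \<le> card ((S' \<union> T') \<inter> L) \<and> (S' \<union> T') - L \<noteq> {} \<or>
        2 \<le> card ((S' \<union> T') \<inter> L') \<and> (S' \<union> T') - L' \<noteq> {}" using that by simp
  qed
  have aS: "insert a S \<subseteq> L - L'" "card (insert a S) = 4" using a S fin by auto
  have Tx: "T - {x} \<subseteq> L' - L" "card (T - {x}) = 2" using T x fin by auto
  have "S \<union> (T - {x}) \<in> H" using S Tx by (intro face) auto
  moreover have "card (S \<union> (T - {x})) = 5" using counts_of_parts[OF S(1) Tx(1)] S Tx by simp
  ultimately have "a \<in> F" using F[of "S \<union> (T - {x})" a] nonface[OF aS(1) Tx(1) aS(2) Tx(2)] sub a V by auto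
  obtain y where y: "y \<in> T - {x}" using Tx(2) by (metis card.empty ex_in_conv zero_neq_numeral)
  have y': "{y} \<subseteq> L' - L" "{x, y} \<subseteq> L' - L" "card {x, y} = 2" using y T x by auto
  have "insert a S \<union> {y} \<in> H" using aS y' by (intro face) auto
  moreover have "card (insert a S \<union> {y}) = 5" using counts_of_parts[OF aS(1) y'(1)] aS by simp
  moreover have "insert a S \<union> {y} \<subseteq> F" using \<open>a \<in> F\<close> y sub by auto
  ultimately have "insert x (insert a S \<union> {y}) \<in> H" using \<open>x \<notin> F\<close> x T V by (intro F) auto
  moreover have "insert x (insert a S \<union> {y}) = insert a S \<union> {x, y}" by auto
  ultimately show False using nonface[OF aS(1) y'(2) aS(2) y'(3)] by simp
qed

text \<open>A flat of \<open>J\<close> separating \<open>S \<union> T\<close> misses one point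
  \<open>x\<close> of \<open>S\<close> or of \<open>T\<close>, but the closure argument forces
  \<open>x\<close> into the flat.\<close>

lemma TBRSC_imp_small_diff:
  assumes "TBRSC V H"
  shows "card (L - L') \<le> 3 \<or> card (L' - L) \<le> 3"
proof (rule ccontr)
  assume *: "\<not> ?thesis"
  interpret swap: B2_sum V L' L by (rule B2_sum_swap) unfold_locales
  have swap_H: "swap.H = H" by (simp add: swap.H_def H_def complex_sum_commute)
  obtain S where S: "S \<subseteq> L - L'" "card S = 3"
    using * obtain_subset_with_card_n[of 3 "L - L'"] by auto
  obtain T where T: "T \<subseteq> L' - L" "card T = 3"
    using * obtain_subset_with_card_n[of 3 "L' - L"] by auto
  have "S \<noteq> L - L'" "T \<noteq> L' - L" using * S T by auto
  then obtain a b where a: "a \<in> (L - L') - S" and b: "b \<in> (L' - L) - T" using S T by blast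
  have 6: "card (S \<union> T) = 6" using counts_of_parts[OF S(1) T(1)] S T by simp
  have "S \<union> T \<subseteq> V" using S T L_sub L'_sub by blast
  then have ST: "S \<union> T \<in> H"
    using face6_iff[OF _ 6] counts_of_parts[OF S(1) T(1)] S T by (simp add: good6_def)
  obtain J k where J: "BRSC V J" "H = J \<inter> P\<^sub>\<le> k V" using assms by (auto simp: TBRSC_def)
  have k: "k \<ge> 6" using ST J(2) 6 by (auto simp: subsets_le_def)
  have "S \<union> T \<in> J" "S \<union> T \<noteq> {}" using ST J(2) 6 by auto
  then obtain x F where x: "x \<in> S \<union> T" "flat V J F" "(S \<union> T) \<inter> F = S \<union> T - {x}"
    using BRSC_imp_separating_flat[OF J(1)] by metis
  \<comment> \<open>As \<open>k \<ge> 6\<close>, six point sets survive the truncation, so a flat of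
    \<open>J\<close> acts on five point faces like a flat of \<open>H\<close>.\<close>
  have F: "insert p Y \<in> H" if "Y \<in> H" "card Y = 5" "Y \<subseteq> F" "p \<in> V - F" for Y p
  proof -
    have "insert p Y \<in> J" using that x(2) J(2) by (auto simp: flat_def)
    moreover have "card (insert p Y) \<le> k" using card_insert_le_m1[of k Y p] that(2) k by simp
    ultimately show ?thesis using J(2) that H_sub[OF that(1)] by (auto simp: subsets_le_def)
  qed
  have "x \<notin> F" using x by blast
  show False
  proof (cases "x \<in> T")
    case True
    then have "S \<union> (T - {x}) \<subseteq> F" using x S T by blast
    then show False using closure_contains_missing[OF F S T a True] \<open>x \<notin> F\<close> by blast
  next
    case False
    then have "x \<in> S" "T \<union> (S - {x}) \<subseteq> F" using x by auto
    then show False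
      using swap.closure_contains_missing[OF F[folded swap_H] T S b] \<open>x \<notin> F\<close> unfolding swap_H by blast
  qed
qed

end

theorem theorem8p2:
  fixes V L L' :: "'a set"
  assumes "finite V"
    and "L \<in> P\<^sub>\<ge> 2 V - {V}"
    and "L' \<in> P\<^sub>\<ge> 2 V - {V}"
  shows "(BRSC V (B2 V L \<boxplus> B2 V L') \<longleftrightarrow> TBRSC V (B2 V L \<boxplus> B2 V L')) \<and>
         (TBRSC V (B2 V L \<boxplus> B2 V L') \<longleftrightarrow> card (L - L') \<le> 3 \<or> card (L' - L) \<le> 3)"
proof -
  interpret B2_sum V L L' using assms by unfold_locales (auto simp: subsets_ge_def)
  interpret swap: B2_sum V L' L by (rule B2_sum_swap) unfold_locales
  have swap_H: "swap.H = H" by (simp add: swap.H_def H_def complex_sum_commute)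
  \<comment> \<open>The second alternative is the first for the exchanged sets, and the sum is
    commutative.\<close>
  have "BRSC V H" if "card (L - L') \<le> 3 \<or> card (L' - L) \<le> 3"
    using that BRSC_if_small_diff swap.BRSC_if_small_diff swap_H by auto
  then show ?thesis
    using BRSC_imp_TBRSC[of V H] TBRSC_imp_small_diff unfolding H_def by blast
qed

end
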